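(* Let $\Omega\subset\mathbb{R}^n$ be a bounded domain and $0<\alpha\le1$. Let $\delta(x)=\operatorname{dist}(x,\mathbb{R}^n\setminus\Omega)$, $R=\max_\Omega\delta$, $\Gamma=\{x\in\Omega:\delta(x)=R\}$, let $\Gamma_1\subset\Gamma$ be an arbitrary closed non-empty subset, and let $\rho_1(x)=\operatorname{dist}(x,\Gamma_1)$. Then the function $$u(x)=\frac{\delta(x)^\alpha}{\delta(x)^\alpha+\rho_1(x)^\alpha}$$ solves the Dirichlet problem $$\mathcal{L}_\infty u=0\ \text{ in }\Omega\setminus\Gamma_1\ \text{(in the viscosity sense)},\qquad u=0\ \text{ in }\mathbb{R}^n\setminus\Omega,\qquad u=1\ \text{ on }\Gamma_1,$$ and is therefore a first $\infty$-eigenfunction in $\Omega$.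
   Context: For a function $u$ on $\mathbb{R}^n$, $$\mathcal{L}^+_\infty u(x)=\sup_{y\in\mathbb{R}^n,\,y\ne x}\frac{u(y)-u(x)}{|y-x|^\alpha},\quad \mathcal{L}^-_\infty u(x)=\inf_{y\in\mathbb{R}^n,\,y\neq x}\frac{u(y)-u(x)}{|y-x|^\alpha},\quad \mathcal{L}_\infty u=\mathcal{L}_\infty^+u+\mathcal{L}_\infty^-u .$$ $C_0(\overline\Omega)$ denotes the continuous functions on $\overline\Omega$ vanishing on $\partial\Omega$, extended by zero to $\mathbb{R}^n$. $C_0^1(\mathbb{R}^n)$ denotes compactly supported $C^1$ functions. A function $\phi$ touches $u$ from below (above) at $x_0$ if $\phi(x_0)=u(x_0)$ and $\phi\le u$ ($\phi\ge u$) in $\mathbb{R}^n$. The equation $\mathcal{L}_\infty u=0$ holds in the viscosity sense in an open set $D$ if, for each $x_0\in D$, $\mathcal{L}_\infty\phi(x_0)\le0$ for all $\phi\in C_0^1(\mathbb{R}^n)$ touching $u$ from below at $x_0$ and $\mathcal{L}_\infty\psi(x_0)\ge0$ for all $\psi\in C_0^1(\mathbb{R}^n)$ touching $u$ from above at $x_0$. Put $\Lambda_\infty^\alpha=R^{-\alpha}$. A first $\infty$-eigenfunction in $\Omega$ is a function $u\in C_0(\overline\Omega)$, $u>0$ in $\Omega$, which is a viscosity solution in $\Omega$ of $\max\{\mathcal{L}_\infty u,\ \mathcal{L}_\infty^-u+\Lambda_\infty^\alpha u\}=0$, meaning: (supersolution) $\mathcal{L}_\infty\phi(x_0)\le0$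 and $\mathcal{L}_\infty^-\phi(x_0)+\Lambda_\infty^\alpha\phi(x_0)\le0$ whenever $\phi\in C_0^1(\mathbb{R}^n)$ touches $u$ from below at $x_0\in\Omega$; and (subsolution) $\mathcal{L}_\infty\psi(x_0)\ge0$ or $\mathcal{L}_\infty^-\psi(x_0)+\Lambda_\infty^\alpha\psi(x_0)\ge0$ whenever $\psi\in C_0^1(\mathbb{R}^n)$ touches $u$ from above at $x_0\in\Omega$. *)

theory Defs
  imports "HOL-Analysis.Analysis"
begin

definition boundary_dist :: "'a::euclidean_space set \<Rightarrow> 'a \<Rightarrow> real" where
  "boundary_dist \<Omega> x = infdist x (- \<Omega>)"

text \<open>For a nonempty bounded open set the supremum is a maximum, see \<open>inradius_attained\<close> below.\<close>

definition inradius :: "'a::euclidean_space set \<Rightarrow> real" where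
  "inradius \<Omega> = (SUP x\<in>\<Omega>. boundary_dist \<Omega> x)"

definition high_ridge :: "'a::euclidean_space set \<Rightarrow> 'a set" where
  "high_ridge \<Omega> = {x \<in> \<Omega>. boundary_dist \<Omega> x = inradius \<Omega>}"

lemma inradius_attained:
  fixes \<Omega> :: "'a::euclidean_space set"
  assumes "open \<Omega>" "bounded \<Omega>" "\<Omega> \<noteq> {}"
  shows "\<exists>x\<in>\<Omega>. boundary_dist \<Omega> x = inradius \<Omega> \<and> (\<forall>y\<in>\<Omega>. boundary_dist \<Omega> y \<le> boundary_dist \<Omega> x)"
proof -
  let ?d = "boundary_dist \<Omega>"
  have ne: "- \<Omega> \<noteq> {}"
    using \<open>bounded \<Omega>\<close> not_bounded_UNIV by (metis Compl_empty_eq double_complement)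
  have cl: "closed (- \<Omega>)"
    using \<open>open \<Omega>\<close> by auto
  have cont: "continuous_on (closure \<Omega>) ?d"
    unfolding boundary_dist_def by (intro continuous_intros)
  obtain x where x: "x \<in> closure \<Omega>" and max: "\<And>y. y \<in> closure \<Omega> \<Longrightarrow> ?d y \<le> ?d x"
    using continuous_attains_sup[OF _ _ cont] assms by (auto simp: compact_closure)
  have pos: "?d y > 0" if "y \<in> \<Omega>" for y
    using that in_closed_iff_infdist_zero[OF cl ne] infdist_nonneg[of y "- \<Omega>"]
    unfolding boundary_dist_def by (metis ComplD less_eq_real_def)
  obtain z where z: "z \<in> \<Omega>" using assms by auto
  have "?d x > 0" using pos[OF z] max[of z] z closure_subset by fastforce
  then have xin: "x \<in> \<Omega>"
    unfolding boundary_dist_def by (metis ComplI infdist_zero less_irrefl)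
  have le: "?d y \<le> ?d x" if "y \<in> \<Omega>" for y
    using max that closure_subset by blast
  have "inradius \<Omega> = ?d x"
    unfolding inradius_def by (rule cSup_eq_maximum) (use xin le in auto)
  then show ?thesis using xin le by auto
qed

text \<open>The supremum and the infimum are taken in the reals, where they are meaningful only for a
  family of quotients that is bounded. The operators are applied below only to test functions,
  for which the quotients are bounded, see \<open>test_fun_quotient_bounded\<close>.\<close>

definition Linf_plus :: "real \<Rightarrow> ('a::euclidean_space \<Rightarrow> real) \<Rightarrow> 'a \<Rightarrow> real" where
  "Linf_plus \<alpha> u x = (SUP y\<in>{y. y \<noteq> x}. (u y - u x) / norm (y - x) powr \<alpha>)"

definition Linf_minus :: "real \<Rightarrow> ('a::euclidean_space \<Rightarrow> real) \<Rightarrow> 'a \<Rightarrow> real" where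
  "Linf_minus \<alpha> u x = (INF y\<in>{y. y \<noteq> x}. (u y - u x) / norm (y - x) powr \<alpha>)"

definition Linf :: "real \<Rightarrow> ('a::euclidean_space \<Rightarrow> real) \<Rightarrow> 'a \<Rightarrow> real" where
  "Linf \<alpha> u x = Linf_plus \<alpha> u x + Linf_minus \<alpha> u x"

text \<open>Elements of \<open>C0_closure \<Omega>\<close> are represented by their extension by zero to the whole space.\<close>

definition C0_closure :: "'a::euclidean_space set \<Rightarrow> ('a \<Rightarrow> real) set" where
  "C0_closure \<Omega> = {u. continuous_on (closure \<Omega>) u \<and> (\<forall>x\<in>frontier \<Omega>. u x = 0)
                      \<and> (\<forall>x. x \<notin> closure \<Omega> \<longrightarrow> u x = 0)}"

definition C01 :: "('a::euclidean_space \<Rightarrow> real) set" where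
  "C01 = {\<phi>. compact (closure {x. \<phi> x \<noteq> 0}) \<and>
            (\<exists>\<phi>' :: 'a \<Rightarrow> 'a \<Rightarrow>\<^sub>L real. (\<forall>x. (\<phi> has_derivative blinfun_apply (\<phi>' x)) (at x))
                                  \<and> continuous_on UNIV \<phi>')}"

lemma test_fun_quotient_bounded:
  fixes \<phi> :: "'a::euclidean_space \<Rightarrow> real"
  assumes "\<phi> \<in> C01" "0 < \<alpha>" "\<alpha> \<le> 1"
  shows "\<exists>C. \<forall>y. y \<noteq> x \<longrightarrow> \<bar>(\<phi> y - \<phi> x) / norm (y - x) powr \<alpha>\<bar> \<le> C"
proof -
  obtain \<phi>' :: "'a \<Rightarrow> 'a \<Rightarrow>\<^sub>L real" where
    der: "\<And>x. (\<phi> has_derivative blinfun_apply (\<phi>' x)) (at x)" and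
    cont': "continuous_on UNIV \<phi>'" and
    comp: "compact (closure {x. \<phi> x \<noteq> 0})"
    using assms unfolding C01_def by auto
  have cont: "continuous_on S \<phi>" for S
    using der has_derivative_continuous continuous_at_imp_continuous_on by blast
  have "bounded (\<phi> ` closure {x. \<phi> x \<noteq> 0})"
    using compact_continuous_image[OF cont comp] compact_imp_bounded by blast
  then obtain M where M: "\<And>y. y \<in> closure {x. \<phi> x \<noteq> 0} \<Longrightarrow> \<bar>\<phi> y\<bar> \<le> M"
    unfolding bounded_iff by auto
  have M': "\<bar>\<phi> y\<bar> \<le> max M 0" for y
    using M[of y] closure_subset[of "{x. \<phi> x \<noteq> 0}"] by (cases "\<phi> y = 0") auto
  have "bounded (\<phi>' ` cball x 1)"
    using compact_continuous_image[OF continuous_on_subset[OF cont'] compact_cball]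
      compact_imp_bounded by blast
  then obtain B where B: "\<And>y. y \<in> cball x 1 \<Longrightarrow> norm (\<phi>' y) \<le> B"
    unfolding bounded_iff by blast
  have B0: "0 \<le> B" using order_trans[OF norm_ge_zero B[of x]] by simp
  have "\<bar>(\<phi> y - \<phi> x) / norm (y - x) powr \<alpha>\<bar> \<le> max B (2 * max M 0)" if "y \<noteq> x" for y
  proof (cases "norm (y - x) \<le> 1")
    case True
    have npos: "0 < norm (y - x)" using that by simp
    have "norm (\<phi> y - \<phi> x) \<le> B * norm (y - x)"
    proof (rule differentiable_bound[of "cball x 1" \<phi> "\<lambda>z. blinfun_apply (\<phi>' z)"])
      show "convex (cball x 1)" by simp
      show "(\<phi> has_derivative blinfun_apply (\<phi>' z)) (at z within cball x 1)" for z
        using der has_derivative_at_withinI by blast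
      show "onorm (blinfun_apply (\<phi>' z)) \<le> B" if "z \<in> cball x 1" for z
        using B[OF that] by (simp add: norm_blinfun.rep_eq)
    qed (use True in \<open>auto simp: dist_norm norm_minus_commute\<close>)
    also have "\<dots> \<le> B * norm (y - x) powr \<alpha>"
      using powr_mono'[of \<alpha> 1 "norm (y - x)"] assms True B0 npos
      by (intro mult_left_mono) auto
    finally have "\<bar>(\<phi> y - \<phi> x) / norm (y - x) powr \<alpha>\<bar> \<le> B"
      using npos by (simp add: abs_divide divide_le_eq)
    then show ?thesis by simp
  next
    case False
    have "1 \<le> norm (y - x) powr \<alpha>"
      using False assms by (simp add: ge_one_powr_ge_zero)
    then have "\<bar>(\<phi> y - \<phi> x) / norm (y - x) powr \<alpha>\<bar> \<le> \<bar>\<phi> y - \<phi> x\<bar> / 1"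
      unfolding abs_divide by (intro divide_left_mono) auto
    also have "\<dots> \<le> 2 * max M 0"
      using M'[of x] M'[of y] abs_triangle_ineq4[of "\<phi> y" "\<phi> x"]
    unfolding div_by_1 by linarith
    finally show ?thesis by simp
  qed
  then show ?thesis by blast
qed

definition touches_below :: "('a \<Rightarrow> real) \<Rightarrow> ('a \<Rightarrow> real) \<Rightarrow> 'a \<Rightarrow> bool" where
  "touches_below \<phi> u x0 \<longleftrightarrow> \<phi> x0 = u x0 \<and> (\<forall>x. \<phi> x \<le> u x)"

definition touches_above :: "('a \<Rightarrow> real) \<Rightarrow> ('a \<Rightarrow> real) \<Rightarrow> 'a \<Rightarrow> bool" where
  "touches_above \<psi> u x0 \<longleftrightarrow> \<psi> x0 = u x0 \<and> (\<forall>x. \<psi> x \<ge> u x)"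

definition Linf_viscosity_solution ::
    "real \<Rightarrow> 'a::euclidean_space set \<Rightarrow> ('a \<Rightarrow> real) \<Rightarrow> bool" where
  "Linf_viscosity_solution \<alpha> D u \<longleftrightarrow>
     (\<forall>x0\<in>D. (\<forall>\<phi>\<in>C01. touches_below \<phi> u x0 \<longrightarrow> Linf \<alpha> \<phi> x0 \<le> 0)
           \<and> (\<forall>\<psi>\<in>C01. touches_above \<psi> u x0 \<longrightarrow> Linf \<alpha> \<psi> x0 \<ge> 0))"

text \<open>The quantity below already is the \<open>\<alpha>\<close>-th power of \<open>\<Lambda>\<close>, i.e. the coefficient of \<open>u\<close> in the
  eigenvalue equation.\<close>

definition Lambda_inf_pow :: "real \<Rightarrow> 'a::euclidean_space set \<Rightarrow> real" where
  "Lambda_inf_pow \<alpha> \<Omega> = inradius \<Omega> powr (- \<alpha>)"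

definition infinity_eigen_viscosity_solution ::
    "real \<Rightarrow> 'a::euclidean_space set \<Rightarrow> ('a \<Rightarrow> real) \<Rightarrow> bool" where
  "infinity_eigen_viscosity_solution \<alpha> \<Omega> u \<longleftrightarrow>
     (\<forall>x0\<in>\<Omega>.
        (\<forall>\<phi>\<in>C01. touches_below \<phi> u x0 \<longrightarrow>
            Linf \<alpha> \<phi> x0 \<le> 0 \<and> Linf_minus \<alpha> \<phi> x0 + Lambda_inf_pow \<alpha> \<Omega> * \<phi> x0 \<le> 0)
      \<and> (\<forall>\<psi>\<in>C01. touches_above \<psi> u x0 \<longrightarrow>
            Linf \<alpha> \<psi> x0 \<ge> 0 \<or> Linf_minus \<alpha> \<psi> x0 + Lambda_inf_pow \<alpha> \<Omega> * \<psi> x0 \<ge> 0))"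

definition first_infinity_eigenfunction ::
    "real \<Rightarrow> 'a::euclidean_space set \<Rightarrow> ('a \<Rightarrow> real) \<Rightarrow> bool" where
  "first_infinity_eigenfunction \<alpha> \<Omega> u \<longleftrightarrow>
     u \<in> C0_closure \<Omega> \<and> (\<forall>x\<in>\<Omega>. u x > 0) \<and> infinity_eigen_viscosity_solution \<alpha> \<Omega> u"

end

theory Submission
  imports Defs
begin

text \<open>Write \<open>\<delta>\<close> for the boundary distance, \<open>\<rho>\<close> for the distance to \<open>\<Gamma>1\<close>, and
  \<open>c x = 1 / (\<delta> x powr \<alpha> + \<rho> x powr \<alpha>)\<close>. Since \<open>\<delta> powr \<alpha>\<close> and \<open>\<rho> powr \<alpha>\<close> are \<open>\<alpha>\<close>-Hoelder with
  constant \<open>1\<close>, all difference quotients of \<open>u\<close> at \<open>x\<close> lie in \<open>[- c x, c x]\<close>. The value \<open>- c x\<close> is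
  attained at a point of the complement of \<open>\<Omega>\<close> nearest to \<open>x\<close>, and, off \<open>\<Gamma>1\<close>, the value \<open>c x\<close> is
  attained at a nearest point of \<open>\<Gamma>1\<close>. A test function touching \<open>u\<close> inherits the two one-sided
  bounds that its viscosity inequality needs. On \<open>\<Gamma>1\<close> the value \<open>c\<close> is the eigenvalue, by
  \<open>\<delta> = R\<close>.\<close>

text \<open>Dividing by \<open>(s + t) powr a\<close> reduces the claim to the fractions
  \<open>s / p\<close> and \<open>t / p\<close>: they sum to 1, and raising a number in [0, 1] to a
  power \<open>a\<close> of at most 1 does not decrease it.\<close>

lemma powr_add_le_add_powr:
  fixes s t a :: real
  assumes "0 \<le> s" "0 \<le> t" "0 < a" "a \<le> 1"
  shows "(s + t) powr a \<le> s powr a + t powr a"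
proof (cases "s + t = 0")
  case False
  define p where "p = s + t"
  have p: "0 < p" using False assms unfolding p_def by simp
  have le: "r / p \<le> (r / p) powr a" if "0 \<le> r" "r \<le> p" for r
  proof (cases "r = 0")
    case False
    then show ?thesis
      using powr_mono'[of a 1 "r / p"] that p assms by (simp add: divide_le_eq)
  qed simp
  have "1 = s / p + t / p" using p unfolding p_def by (simp flip: add_divide_distrib)
  also have "\<dots> \<le> (s / p) powr a + (t / p) powr a"
    using le[of s] le[of t] assms unfolding p_def by simp
  also have "\<dots> = (s powr a + t powr a) / p powr a"
    using assms p by (simp add: powr_divide add_divide_distrib)
  finally show ?thesis using p by (simp add: le_divide_eq p_def)
qed (use assms in auto)

lemma powr_diff_le_powr_diff:
  fixes s t h a :: real
  assumes "0 \<le> s" "0 \<le> t" "\<bar>s - t\<bar> \<le> h" "0 < a" "a \<le> 1"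
  shows "\<bar>s powr a - t powr a\<bar> \<le> h powr a"
proof -
  have *: "s powr a \<le> t powr a + h powr a" if "0 \<le> s" "0 \<le> t" "\<bar>s - t\<bar> \<le> h" for s t
  proof -
    have "s powr a \<le> (t + h) powr a"
      using that assms by (intro powr_mono2) auto
    also have "\<dots> \<le> t powr a + h powr a"
      using that assms by (intro powr_add_le_add_powr) auto
    finally show ?thesis .
  qed
  show ?thesis using *[of s t] *[of t s] assms by (simp add: abs_minus_commute)
qed

lemma infdist_powr_Holder:
  fixes x y :: "'a::euclidean_space"
  assumes "0 < \<alpha>" "\<alpha> \<le> 1"
  shows "\<bar>infdist x A powr \<alpha> - infdist y A powr \<alpha>\<bar> \<le> norm (y - x) powr \<alpha>"
  using assms infdist_triangle_abs[of x A y]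
  by (intro powr_diff_le_powr_diff infdist_nonneg) (auto simp: dist_norm norm_minus_commute)

text \<open>The numerator \<open>b * r - a * s\<close> splits into two differences with total weight
  \<open>b + s\<close>, which cancels one denominator. Only \<open>a + r\<close> survives, so the
  Hoelder constant of \<open>u\<close> depends on the base point alone.\<close>

lemma abs_ratio_diff_le:
  fixes a b r s d :: real
  assumes "0 \<le> b" "0 \<le> s" "0 < a + r" "0 < b + s" "\<bar>a - b\<bar> \<le> d" "\<bar>r - s\<bar> \<le> d"
  shows "\<bar>b / (b + s) - a / (a + r)\<bar> \<le> d / (a + r)"
proof -
  have "b * r - a * s = b * (r - s) - (a - b) * s" by (simp add: algebra_simps)
  also have "\<bar>\<dots>\<bar> \<le> b * \<bar>r - s\<bar> + \<bar>a - b\<bar> * s"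
    using assms by (simp add: order_trans[OF abs_triangle_ineq4] abs_mult)
  also have "\<dots> \<le> b * d + d * s"
    using assms by (intro add_mono mult_mono) auto
  finally have "\<bar>b * r - a * s\<bar> \<le> d * (b + s)" by (simp add: algebra_simps)
  moreover have "b / (b + s) - a / (a + r) = (b * r - a * s) / ((b + s) * (a + r))"
    using assms by (simp add: field_simps)
  then have "\<bar>b / (b + s) - a / (a + r)\<bar> = \<bar>b * r - a * s\<bar> / (b + s) / (a + r)"
    using assms by (simp add: abs_mult abs_divide)
  ultimately show ?thesis
    using assms by (simp add: divide_right_mono divide_le_eq)
qed

context
  fixes \<alpha> :: real and \<phi> :: "'a::euclidean_space \<Rightarrow> real" and x :: 'a
begin

lemma Linf_plus_le:
  assumes "\<And>y. y \<noteq> x \<Longrightarrow> \<phi> y - \<phi> x \<le> c * norm (y - x) powr \<alpha>"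
  shows "Linf_plus \<alpha> \<phi> x \<le> c"
  unfolding Linf_plus_def
  using assms UNIV_not_singleton[of x] by (intro cSUP_least) (auto simp: divide_le_eq)

lemma Linf_minus_ge:
  assumes "\<And>y. y \<noteq> x \<Longrightarrow> \<phi> y - \<phi> x \<ge> c * norm (y - x) powr \<alpha>"
  shows "Linf_minus \<alpha> \<phi> x \<ge> c"
  unfolding Linf_minus_def
  using assms UNIV_not_singleton[of x] by (intro cINF_greatest) (auto simp: le_divide_eq)

context
  assumes C01: "\<phi> \<in> C01" and \<alpha>: "0 < \<alpha>" "\<alpha> \<le> 1"
begin

text \<open>A single quotient bounds the real-valued supremum from below only when the quotients are
  bounded above; this is where membership in \<open>C01\<close> enters.\<close>

lemma Linf_plus_ge:
  assumes "y \<noteq> x" "\<phi> y - \<phi> x \<ge> c * norm (y - x) powr \<alpha>"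
  shows "Linf_plus \<alpha> \<phi> x \<ge> c"
proof -
  let ?q = "\<lambda>y. (\<phi> y - \<phi> x) / norm (y - x) powr \<alpha>"
  obtain C where "\<And>y. y \<noteq> x \<Longrightarrow> \<bar>?q y\<bar> \<le> C"
    using test_fun_quotient_bounded[OF C01 \<alpha>] by blast
  then have "bdd_above (?q ` {y. y \<noteq> x})"
    by (intro bdd_aboveI2[of _ _ C]) (use abs_le_D1 in blast)
  then have "?q y \<le> Linf_plus \<alpha> \<phi> x"
    unfolding Linf_plus_def using assms(1) by (intro cSUP_upper) auto
  moreover have "c \<le> ?q y" using assms by (simp add: le_divide_eq)
  ultimately show ?thesis by linarith
qed

lemma Linf_minus_le:
  assumes "y \<noteq> x" "\<phi> y - \<phi> x \<le> c * norm (y - x) powr \<alpha>"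
  shows "Linf_minus \<alpha> \<phi> x \<le> c"
proof -
  let ?q = "\<lambda>y. (\<phi> y - \<phi> x) / norm (y - x) powr \<alpha>"
  obtain C where C: "\<And>y. y \<noteq> x \<Longrightarrow> \<bar>?q y\<bar> \<le> C"
    using test_fun_quotient_bounded[OF C01 \<alpha>] by blast
  have "bdd_below (?q ` {y. y \<noteq> x})"
    by (rule bdd_belowI2[of _ "- C"]) (use C abs_le_D2 minus_le_iff in blast)
  then have "Linf_minus \<alpha> \<phi> x \<le> ?q y"
    unfolding Linf_minus_def using assms(1) by (intro cINF_lower) auto
  moreover have "?q y \<le> c" using assms by (simp add: divide_le_eq)
  ultimately show ?thesis by linarith
qed

end

end

theorem theorem36:
  fixes \<Omega> \<Gamma>1 :: "(real ^ 'n) set"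
    and \<alpha> :: real
    and u :: "real ^ 'n \<Rightarrow> real"
  assumes "open \<Omega>" and "connected \<Omega>" and "\<Omega> \<noteq> {}" and "bounded \<Omega>"
    and "0 < \<alpha>" and "\<alpha> \<le> 1"
    and "\<Gamma>1 \<subseteq> high_ridge \<Omega>" and "closed \<Gamma>1" and "\<Gamma>1 \<noteq> {}"
    and "\<And>x. u x = boundary_dist \<Omega> x powr \<alpha> /
                  (boundary_dist \<Omega> x powr \<alpha> + infdist x \<Gamma>1 powr \<alpha>)"
  shows "Linf_viscosity_solution \<alpha> (\<Omega> - \<Gamma>1) u
       \<and> (\<forall>x. x \<notin> \<Omega> \<longrightarrow> u x = 0)
       \<and> (\<forall>x\<in>\<Gamma>1. u x = 1)
       \<and> first_infinity_eigenfunction \<alpha> \<Omega> u"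
proof -
  define a where "a x = boundary_dist \<Omega> x powr \<alpha>" for x
  define r where "r x = infdist x \<Gamma>1 powr \<alpha>" for x
  define c where "c x = 1 / (a x + r x)" for x
  note \<alpha> = \<open>0 < \<alpha>\<close> \<open>\<alpha> \<le> 1\<close>
  have u: "u x = a x / (a x + r x)" for x
    using assms(10) by (simp add: a_def r_def)
  have sub: "\<Gamma>1 \<subseteq> \<Omega>"
    using \<open>\<Gamma>1 \<subseteq> high_ridge \<Omega>\<close> by (auto simp: high_ridge_def)
  have ne: "- \<Omega> \<noteq> {}"
    using \<open>bounded \<Omega>\<close> not_bounded_UNIV by (metis Compl_empty_eq double_complement)
  have cl: "closed (- \<Omega>)"
    using \<open>open \<Omega>\<close> by auto
  have nonneg: "0 \<le> a x" "0 \<le> r x" for x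
    by (auto simp: a_def r_def)
  have bd: "boundary_dist \<Omega> x > 0" if "x \<in> \<Omega>" for x
    unfolding boundary_dist_def using that cl ne by (simp add: infdist_pos_not_in_closed)
  have a0: "a x = 0" if "x \<notin> \<Omega>" for x
    using that by (simp add: a_def boundary_dist_def)
  have a_pos: "a x > 0" if "x \<in> \<Omega>" for x
    using bd[OF that] by (simp add: a_def)
  have r0: "r x = 0" if "x \<in> \<Gamma>1" for x
    using that by (simp add: r_def)
  have r_pos: "r x > 0" if "x \<notin> \<Gamma>1" for x
    using infdist_pos_not_in_closed[OF \<open>closed \<Gamma>1\<close> \<open>\<Gamma>1 \<noteq> {}\<close> that] by (simp add: r_def)
  \<comment> \<open>Since \<open>\<Gamma>1\<close> lies inside \<open>\<Omega>\<close>, every point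
    is in \<open>\<Omega>\<close> or off \<open>\<Gamma>1\<close>, so \<open>a\<close> and
    \<open>r\<close> never vanish together.\<close>
  have pos: "a x + r x > 0" for x
    using a_pos[of x] r_pos[of x] nonneg[of x] sub by fastforce
  have u_out: "u x = 0" if "x \<notin> \<Omega>" for x
    using a0[OF that] by (simp add: u)
  have u_one: "u x = 1" if "x \<in> \<Gamma>1" for x
    using r0[OF that] pos[of x] by (simp add: u)
  have Holder: "\<bar>u y - u x\<bar> \<le> c x * norm (y - x) powr \<alpha>" for x y
    using abs_ratio_diff_le[OF nonneg pos pos, of x y "norm (y - x) powr \<alpha>"]
      infdist_powr_Holder[OF \<alpha>, of x _ y]
    by (simp add: u c_def a_def r_def boundary_dist_def)
  \<comment> \<open>With equality at \<open>x\<close>, contact from below can only lower the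
    quotients based at \<open>x\<close>; contact from above can only raise them.\<close>
  have below_plus: "Linf_plus \<alpha> \<phi> x \<le> c x" if "touches_below \<phi> u x" for \<phi> x
  proof (rule Linf_plus_le)
    show "\<phi> y - \<phi> x \<le> c x * norm (y - x) powr \<alpha>" for y
      using that Holder[of y x] by (smt (verit) touches_below_def)
  qed
  have above_minus: "Linf_minus \<alpha> \<psi> x \<ge> - c x" if "touches_above \<psi> u x" for \<psi> x
  proof (rule Linf_minus_ge)
    show "\<psi> y - \<psi> x \<ge> - c x * norm (y - x) powr \<alpha>" for y
      using that Holder[of y x] by (smt (verit) touches_above_def mult_minus_left)
  qed
  have below_minus: "Linf_minus \<alpha> \<phi> x \<le> - c x"
    if \<phi>: "\<phi> \<in> C01" "touches_below \<phi> u x" and x: "x \<in> \<Omega>" for \<phi> x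
  proof -
    obtain y where y: "y \<notin> \<Omega>" "boundary_dist \<Omega> x = dist x y"
      using infdist_attains_inf[OF cl ne, of x] by (auto simp: boundary_dist_def)
    have "\<phi> y - \<phi> x \<le> - u x"
      using \<phi>(2) u_out[OF y(1)] by (metis touches_below_def diff_0 diff_right_mono)
    \<comment> \<open>As \<open>y\<close> realises the boundary distance,
      \<open>norm (y - x) powr \<alpha>\<close> equals \<open>a x\<close>, and
      \<open>u x = c x * a x\<close>.\<close>
    also have "- u x = - c x * norm (y - x) powr \<alpha>"
      by (simp add: u c_def a_def y dist_norm norm_minus_commute)
    finally show ?thesis
      using y x by (intro Linf_minus_le[OF \<phi>(1) \<alpha>]) auto
  qed
  have above_plus: "Linf_plus \<alpha> \<psi> x \<ge> c x"
    if \<psi>: "\<psi> \<in> C01" "touches_above \<psi> u x" and x: "x \<notin> \<Gamma>1" for \<psi> x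
  proof -
    obtain y where y: "y \<in> \<Gamma>1" "infdist x \<Gamma>1 = dist x y"
      using infdist_attains_inf[OF \<open>closed \<Gamma>1\<close> \<open>\<Gamma>1 \<noteq> {}\<close>, of x] by auto
    have "c x * norm (y - x) powr \<alpha> = r x / (a x + r x)"
      by (simp add: c_def r_def y dist_norm norm_minus_commute)
    also have "\<dots> = 1 - u x"
      using pos[of x] by (simp add: u field_simps)
    also have "\<dots> \<le> \<psi> y - \<psi> x"
      using \<psi>(2) u_one[OF y(1)] by (metis touches_above_def diff_right_mono)
    finally show ?thesis
      using y x by (intro Linf_plus_ge[OF \<psi>(1) \<alpha>]) auto
  qed
  have super: "Linf \<alpha> \<phi> x \<le> 0" if "\<phi> \<in> C01" "touches_below \<phi> u x" "x \<in> \<Omega>" for \<phi> x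
    using below_plus below_minus that by (fastforce simp: Linf_def)
  have subsol: "Linf \<alpha> \<psi> x \<ge> 0" if "\<psi> \<in> C01" "touches_above \<psi> u x" "x \<notin> \<Gamma>1" for \<psi> x
    using above_plus above_minus that by (fastforce simp: Linf_def)
  have eigen_super: "Linf_minus \<alpha> \<phi> x + Lambda_inf_pow \<alpha> \<Omega> * \<phi> x \<le> 0"
    if "\<phi> \<in> C01" "touches_below \<phi> u x" "x \<in> \<Omega>" for \<phi> x
  proof -
    have "boundary_dist \<Omega> x \<le> inradius \<Omega>"
      using inradius_attained[OF assms(1,4,3)] that(3) by auto
    then have "a x \<le> inradius \<Omega> powr \<alpha>" "inradius \<Omega> > 0"
      using bd[OF that(3)] \<alpha> by (auto simp: a_def intro: powr_mono2)
    \<comment> \<open>Dividing this by \<open>a x + r x\<close> bounds the eigenvalue term by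
      \<open>c x\<close>, which \<open>below_minus\<close> compensates.\<close>
    then have "Lambda_inf_pow \<alpha> \<Omega> * a x \<le> 1"
      by (simp add: Lambda_inf_pow_def powr_minus_divide)
    then have "Lambda_inf_pow \<alpha> \<Omega> * a x / (a x + r x) \<le> c x"
      unfolding c_def using pos[of x] by (intro divide_right_mono) auto
    moreover have "\<phi> x = a x / (a x + r x)"
      using that(2) by (simp add: touches_below_def u)
    ultimately show ?thesis
      using below_minus[OF that] by simp
  qed
  \<comment> \<open>On \<open>\<Gamma>1\<close> the nearest point of \<open>\<Gamma>1\<close> is
    \<open>x\<close> itself and gives no quotient, so the second alternative of the subsolution
    condition is proved there.\<close>
  have eigen_sub: "Linf_minus \<alpha> \<psi> x + Lambda_inf_pow \<alpha> \<Omega> * \<psi> x \<ge> 0"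
    if "touches_above \<psi> u x" "x \<in> \<Gamma>1" for \<psi> x
  proof -
    have "boundary_dist \<Omega> x = inradius \<Omega>"
      using \<open>\<Gamma>1 \<subseteq> high_ridge \<Omega>\<close> that(2) by (auto simp: high_ridge_def)
    then have "c x = Lambda_inf_pow \<alpha> \<Omega>"
      using r0[OF that(2)] by (simp add: c_def a_def Lambda_inf_pow_def powr_minus_divide)
    moreover have "\<psi> x = 1"
      using that u_one by (simp add: touches_above_def)
    ultimately show ?thesis
      using above_minus[OF that(1)] by simp
  qed
  have "continuous_on (closure \<Omega>) u"
  proof -
    have "continuous_on (closure \<Omega>) (\<lambda>x. infdist x A powr \<alpha>)" for A
      \<comment> \<open>The distance may vanish; positivity of the exponent keeps the power
        continuous there.\<close>
      using \<alpha> by (intro continuous_on_powr' continuous_intros) (auto simp: infdist_nonneg)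
    then have "continuous_on (closure \<Omega>) a" "continuous_on (closure \<Omega>) r"
      by (simp_all add: a_def[abs_def] r_def[abs_def] boundary_dist_def)
    then have "continuous_on (closure \<Omega>) (\<lambda>x. a x / (a x + r x))"
      using less_imp_neq[OF pos] by (intro continuous_on_divide continuous_on_add) auto
    then show ?thesis by (simp add: u)
  qed
  then have "u \<in> C0_closure \<Omega>"
    \<comment> \<open>An open set is disjoint from its frontier, so \<open>u_out\<close> also
      supplies the boundary values.\<close>
    using u_out \<open>open \<Omega>\<close> closure_subset[of \<Omega>]
    by (auto simp: C0_closure_def frontier_def interior_open)
  moreover have "u x > 0" if "x \<in> \<Omega>" for x
    using a_pos[OF that] pos[of x] by (simp add: u)
  ultimately show ?thesis
    using super subsol eigen_super eigen_sub u_out u_one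
    unfolding Linf_viscosity_solution_def first_infinity_eigenfunction_def
      infinity_eigen_viscosity_solution_def
    by blast
qed

end
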